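(* Let $Q\in\mathbb{R}^{n\times n}$ be a symmetric indefinite matrix, $b\in\mathbb{R}^n$, and $\alpha\in\mathbb{R}^n$ a nonnegative, nonzero vector. Suppose $|b_i|\le\alpha_i$ for all $i=1,\dots,n$. Consider the quadratic program $$\operatorname*{minimize}_{v\in\mathbb{R}^n}\ \tfrac12v^TQv\quad\text{subject to}\quad b^Tv+\sum_{i=1}^n\alpha_i|v_i|\le0.$$ Let $\mathcal{I}_+=\{i:-b_i=\alpha_i>0\}$, $\mathcal{I}_-=\{i:b_i=\alpha_i>0\}$, $\mathcal{I}_f=\{i:b_i=\alpha_i=0\}$ and $\mathcal{I}_{\ne0}=\mathcal{I}_+\cup\mathcal{I}_-$. A necessary and sufficient condition for this quadratic program to have a zero optimum objective value is that the following three conditions hold: $\bullet$ the principal submatrix $Q_{\mathcal{I}_f\mathcal{I}_f}$ is positive semidefinite, with eigen-decomposition $[P_{\mathcal{I}_f\mathcal{I}_f}]^TQ_{\mathcal{I}_f\mathcal{I}_f}[P_{\mathcal{I}_f\mathcal{I}_f}]=\Xi_{\mathcal{I}_f}$; $\bullet$ $\begin{bmatrix}Q_{\mathcal{I}_+\mathcal{I}_f}\\ Q_{\mathcal{I}_-\mathcal{I}_f}\end{bmatrix}P_{\mathcal{I}_f\mathcal{I}_f^0}=0$; $\bullet$ the Schur complement $$\begin{bmatrix}Q_{\mathcal{I}_+\mathcal{I}_+}&-Q_{\mathcal{I}_+\mathcal{I}_-}\\-Q_{\mathcal{I}_-\mathcal{I}_+}&Q_{\mathcal{I}_-\mathcal{I}_-}\end{bmatrix}-\begin{bmatrix}Q_{\mathcal{I}_+\mathcal{I}_f}P_{\mathcal{I}_f\mathcal{I}_f^+}\\-Q_{\mathcal{I}_-\mathcal{I}_f}P_{\mathcal{I}_f\mathcal{I}_f^+}\end{bmatrix}\big[\Xi_{\mathcal{I}_f^+}\big]^{-1}\begin{bmatrix}Q_{\mathcal{I}_+\mathcal{I}_f}P_{\mathcal{I}_f\mathcal{I}_f^+}\\-Q_{\mathcal{I}_-\mathcal{I}_f}P_{\mathcal{I}_f\mathcal{I}_f^+}\end{bmatrix}^T$$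 is copositive on $\mathbb{R}_+^{|\mathcal{I}_{\ne0}|}$.
   Context: For index sets $\mathcal I,\mathcal J$, $Q_{\mathcal I\mathcal J}$ is the submatrix of $Q$ with rows in $\mathcal I$ and columns in $\mathcal J$. In the eigen-decomposition, $P_{\mathcal{I}_f\mathcal{I}_f}$ is an orthogonal matrix of order $|\mathcal{I}_f|$ whose columns are normalized eigenvectors of $Q_{\mathcal{I}_f\mathcal{I}_f}$, and $\Xi_{\mathcal{I}_f}$ is the diagonal matrix of the corresponding eigenvalues (nonnegative when $Q_{\mathcal{I}_f\mathcal{I}_f}$ is positive semidefinite). The index set $\mathcal{I}_f$ (indexing the eigenvectors) is partitioned into complementary subsets $\mathcal{I}_f^+$ and $\mathcal{I}_f^0$ corresponding to the positive and zero eigenvalues, so that $\Xi_{\mathcal{I}_f}=\begin{bmatrix}\Xi_{\mathcal{I}_f^+}&0\\0&0\end{bmatrix}$ with $\Xi_{\mathcal{I}_f^+}$ diagonal with positive diagonal entries; $P_{\mathcal{I}_f\mathcal{I}_f^+}$ and $P_{\mathcal{I}_f\mathcal{I}_f^0}$ are the corresponding column submatrices of $P_{\mathcal{I}_f\mathcal{I}_f}$. Blocks indexed by empty sets are vacuous. A symmetric matrix $M$ is copositive on a cone $C$ if $v^TMv\ge0$ for all $v\in C$. *)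

theory Defs
  imports
    "Jordan_Normal_Form.Char_Poly"
    "Jordan_Normal_Form.DL_Submatrix"
    "Jordan_Normal_Form.Gauss_Jordan_Elimination"
begin

(* Vectors and matrices have 0-based indices, so index sets are subsets of {..<n}.  The entries
   of a submatrix are renumbered in increasing order of the selected indices. *)

definition symmetric :: "real mat \<Rightarrow> bool" where
  "symmetric A \<longleftrightarrow> square_mat A \<and> transpose_mat A = A"

definition quad_form :: "real mat \<Rightarrow> real vec \<Rightarrow> real" where
  "quad_form A v = v \<bullet> (A *\<^sub>v v)"

definition pos_semidef :: "real mat \<Rightarrow> bool" where
  "pos_semidef A \<longleftrightarrow> symmetric A \<and> (\<forall>v \<in> carrier_vec (dim_row A). quad_form A v \<ge> 0)"

definition indefinite :: "real mat \<Rightarrow> bool" where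
  "indefinite A \<longleftrightarrow>
     (\<exists>v \<in> carrier_vec (dim_row A). quad_form A v > 0) \<and>
     (\<exists>v \<in> carrier_vec (dim_row A). quad_form A v < 0)"

definition copositive_on :: "real mat \<Rightarrow> real vec set \<Rightarrow> bool" where
  "copositive_on M C \<longleftrightarrow> symmetric M \<and> (\<forall>v \<in> C. quad_form M v \<ge> 0)"

definition nonneg_orthant :: "nat \<Rightarrow> real vec set" where
  "nonneg_orthant k = {v \<in> carrier_vec k. \<forall>i<k. v $ i \<ge> 0}"

(* The library's orthogonal_mat only asks for pairwise orthogonal nonzero columns. *)
definition orthonormal_mat :: "nat \<Rightarrow> real mat \<Rightarrow> bool" where
  "orthonormal_mat m P \<longleftrightarrow>
     P \<in> carrier_mat m m \<and> transpose_mat P * P = 1\<^sub>m m \<and> P * transpose_mat P = 1\<^sub>m m"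

definition eigen_decomposition :: "real mat \<Rightarrow> real mat \<Rightarrow> real mat \<Rightarrow> bool" where
  "eigen_decomposition A P \<Xi> \<longleftrightarrow>
     (let m = dim_row A in
       orthonormal_mat m P \<and> \<Xi> \<in> carrier_mat m m \<and> diagonal_mat \<Xi> \<and>
       (\<forall>j<m. eigenvector A (col P j) (\<Xi> $$ (j, j))) \<and>
       transpose_mat P * A * P = \<Xi>)"

(* Eigenvectors are numbered 0, ..., m - 1 in the order of the columns of P; the diagonal of
   \<Xi> need not be sorted. *)
definition pos_eigs :: "real mat \<Rightarrow> nat set" where
  "pos_eigs \<Xi> = {j. j < dim_row \<Xi> \<and> \<Xi> $$ (j, j) > 0}"

definition zero_eigs :: "real mat \<Rightarrow> nat set" where
  "zero_eigs \<Xi> = {j. j < dim_row \<Xi> \<and> \<Xi> $$ (j, j) = 0}"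

definition is_optimum_value :: "('a \<Rightarrow> real) \<Rightarrow> 'a set \<Rightarrow> real \<Rightarrow> bool" where
  "is_optimum_value f S z \<longleftrightarrow> (\<exists>v. is_arg_min f (\<lambda>x. x \<in> S) v \<and> f v = z)"

definition feasible :: "nat \<Rightarrow> real vec \<Rightarrow> real vec \<Rightarrow> real vec set" where
  "feasible n b \<alpha> = {v \<in> carrier_vec n. b \<bullet> v + (\<Sum>i<n. \<alpha> $ i * \<bar>v $ i\<bar>) \<le> 0}"

definition I_plus :: "nat \<Rightarrow> real vec \<Rightarrow> real vec \<Rightarrow> nat set" where
  "I_plus n b \<alpha> = {i. i < n \<and> - (b $ i) = \<alpha> $ i \<and> \<alpha> $ i > 0}"

definition I_minus :: "nat \<Rightarrow> real vec \<Rightarrow> real vec \<Rightarrow> nat set" where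
  "I_minus n b \<alpha> = {i. i < n \<and> b $ i = \<alpha> $ i \<and> \<alpha> $ i > 0}"

definition I_free :: "nat \<Rightarrow> real vec \<Rightarrow> real vec \<Rightarrow> nat set" where
  "I_free n b \<alpha> = {i. i < n \<and> b $ i = 0 \<and> \<alpha> $ i = 0}"

definition schur_complement ::
    "real mat \<Rightarrow> nat set \<Rightarrow> nat set \<Rightarrow> nat set \<Rightarrow> real mat \<Rightarrow> real mat \<Rightarrow> real mat" where
  "schur_complement Q Jp Jm Jf P \<Xi> =
     (let Pp = submatrix P UNIV (pos_eigs \<Xi>);
          \<Xi>p = submatrix \<Xi> (pos_eigs \<Xi>) (pos_eigs \<Xi>);
          B = (submatrix Q Jp Jf * Pp) @\<^sub>r (- (submatrix Q Jm Jf * Pp))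
      in four_block_mat
           (submatrix Q Jp Jp) (- submatrix Q Jp Jm)
           (- submatrix Q Jm Jp) (submatrix Q Jm Jm)
         - B * the (mat_inverse \<Xi>p) * transpose_mat B)"

definition kernel_condition ::
    "real mat \<Rightarrow> nat set \<Rightarrow> nat set \<Rightarrow> nat set \<Rightarrow> real mat \<Rightarrow> real mat \<Rightarrow> bool" where
  "kernel_condition Q Jp Jm Jf P \<Xi> \<longleftrightarrow>
     (submatrix Q Jp Jf @\<^sub>r submatrix Q Jm Jf) * submatrix P UNIV (zero_eigs \<Xi>)
       = 0\<^sub>m (card Jp + card Jm) (card (zero_eigs \<Xi>))"

end

theory Submission
  imports Defs
begin

text \<open>Since \<open>\<bar>b\<^sub>i\<bar> \<le> \<alpha>\<^sub>i\<close>, every summand of the constraint is nonnegative, so the feasible set is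
  a cone given by sign conditions: \<open>v\<close> is nonnegative on \<open>\<I>\<^sub>+\<close>, nonpositive on \<open>\<I>\<^sub>-\<close>, free on
  \<open>\<I>\<^sub>f\<close> and zero elsewhere. The optimum is therefore zero iff the quadratic form is nonnegative
  on this cone. After flipping the signs on \<open>\<I>\<^sub>-\<close> and passing to eigenvector coordinates \<open>u\<close> on
  \<open>\<I>\<^sub>f\<close>, the form reads \<open>w\<^sup>T M w + 2 w\<^sup>T D u + \<Sum>\<^sub>l \<xi>\<^sub>l u\<^sub>l\<^sup>2\<close> with \<open>w \<ge> 0\<close> and \<open>u\<close> free. Setting
  \<open>w = 0\<close> gives \<open>\<xi> \<ge> 0\<close>; letting \<open>u\<^sub>l\<close> tend to infinity where \<open>\<xi>\<^sub>l = 0\<close> gives the kernel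
  condition; completing the square in the remaining coordinates leaves the Schur complement.\<close>

section \<open>Quadratic forms and matrix products as finite sums\<close>

lemma quad_form_sum:
  assumes "A \<in> carrier_mat m m" "v \<in> carrier_vec m"
  shows "quad_form A v = (\<Sum>i<m. \<Sum>j<m. A $$ (i, j) * v $ i * v $ j)"
  using assms unfolding quad_form_def scalar_prod_def
  by (auto simp: scalar_prod_def sum_distrib_left atLeast0LessThan ac_simps intro!: sum.cong)

lemma mult_mat_index_sum:
  assumes "A \<in> carrier_mat m p" "B \<in> carrier_mat p q" "i < m" "j < q"
  shows "(A * B) $$ (i, j) = (\<Sum>h<p. A $$ (i, h) * B $$ (h, j))"
  using assms by (auto simp: scalar_prod_def atLeast0LessThan intro!: sum.cong)

section \<open>The spectral theorem for real symmetric matrices\<close>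

text \<open>The fundamental theorem of algebra gives a complex eigenvalue \<open>z\<close> with
  eigenvector \<open>w\<close>. The Hermitian form \<open>S\<close> of \<open>A\<close> at
  \<open>w\<close> equals \<open>z\<close> times the squared norm of \<open>w\<close>, and it is its
  own conjugate because \<open>A\<close> is real and symmetric. Hence \<open>z\<close> is
  real.\<close>

lemma symmetric_real_eigenvalue:
  assumes A: "(A :: real mat) \<in> carrier_mat m m" and sym: "transpose_mat A = A" and m: "m > 0"
  shows "\<exists>e. eigenvalue A e"
proof -
  define B where "B = map_mat complex_of_real A"
  have B: "B \<in> carrier_mat m m" using A by (simp add: B_def)
  have "degree (char_poly B) = m" using degree_monic_char_poly[OF B] by simp
  hence "\<not> constant (poly (char_poly B))" using m by (simp add: constant_degree)
  then obtain z where z: "poly (char_poly B) z = 0" using fundamental_theorem_of_algebra by blast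
  hence "eigenvalue B z" using eigenvalue_root_char_poly[OF B] by simp
  then obtain w where w: "w \<in> carrier_vec m" "w \<noteq> 0\<^sub>v m" "B *\<^sub>v w = z \<cdot>\<^sub>v w"
    using B by (auto simp: eigenvalue_def eigenvector_def)
  have ent: "(\<Sum>j<m. A $$ (i, j) * w $ j) = z * w $ i" if "i < m" for i
  proof -
    have "(B *\<^sub>v w) $ i = (\<Sum>j<m. A $$ (i, j) * w $ j)"
      using that A w(1) by (auto simp: B_def scalar_prod_def atLeast0LessThan intro!: sum.cong)
    thus ?thesis using w that by simp
  qed
  define S where "S = (\<Sum>i<m. \<Sum>j<m. A $$ (i, j) * w $ j * cnj (w $ i))"
  have S1: "S = z * of_real (\<Sum>i<m. (cmod (w $ i))\<^sup>2)"
  proof -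
    have "S = (\<Sum>i<m. z * w $ i * cnj (w $ i))"
      unfolding S_def by (intro sum.cong refl) (simp add: sum_distrib_right[symmetric] ent)
    thus ?thesis by (simp add: sum_distrib_left complex_norm_square mult.assoc del: of_real_power)
  qed
  have symA: "A $$ (i, j) = A $$ (j, i)" if "i < m" "j < m" for i j
    using that A sym by (metis carrier_matD index_transpose_mat(1))
  have "cnj S = (\<Sum>j<m. \<Sum>i<m. A $$ (i, j) * cnj (w $ j) * w $ i)"
    unfolding S_def by (subst sum.swap) simp
  also have "\<dots> = S" unfolding S_def
    by (intro sum.cong refl) (auto simp: symA)
  finally have S2: "cnj S = S" .
  define N where "N = (\<Sum>i<m. (cmod (w $ i))\<^sup>2)"
  obtain i where i: "i < m" "w $ i \<noteq> 0"
    using w(1,2) by (metis carrier_vecD eq_vecI index_zero_vec)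
  have "N > 0" unfolding N_def by (rule sum_pos2[of _ i]) (use i in auto)
  hence "cnj z = z" using S1 S2 by (simp flip: N_def)
  hence zr: "z = of_real (Re z)" by (simp add: complex_eq_iff)
  \<comment> \<open>Forming the characteristic polynomial commutes with the embedding of the reals,
    so the real number \<open>z\<close> is already a root over the reals.\<close>
  have "poly (map_poly complex_of_real (char_poly A)) z = 0"
    using z by (simp only: B_def of_real_hom.char_poly_hom[OF A])
  hence "poly (map_poly of_real (char_poly A)) (complex_of_real (Re z)) = 0"
    by (simp only: zr[symmetric])
  hence "poly (char_poly A) (Re z) = 0" by simp
  thus ?thesis using eigenvalue_root_char_poly[OF A] by blast
qed

text \<open>The Householder reflection mapping the first unit vector to \<open>v\<close>. If \<open>v\<close> is that unit vector,
  then \<open>c = 2 / 0 = 0\<close> and \<open>H\<close> is the identity.\<close>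

lemma householder:
  fixes v :: "real vec"
  assumes v: "v \<in> carrier_vec m" and vv: "v \<bullet> v = 1" and m: "m > 0"
  shows "\<exists>H \<in> carrier_mat m m. transpose_mat H = H \<and> H * H = 1\<^sub>m m \<and> col H 0 = v"
proof -
  define u where "u i = v $ i - (if i = 0 then 1 else 0)" for i
  define N where "N = (\<Sum>i<m. u i * u i)"
  define c where "c = 2 / N"
  define H where "H = mat m m (\<lambda>(i,j). (if i = j then 1 else 0) - c * u i * u j)"
  have H: "H \<in> carrier_mat m m" by (simp add: H_def)
  have vs: "(\<Sum>i<m. v $ i * v $ i) = 1"
    using vv v by (simp add: scalar_prod_def atLeast0LessThan)
  have "N = (\<Sum>i<m. v $ i * v $ i - (if i = 0 then 2 * v $ 0 - 1 else 0))"
    unfolding N_def u_def by (intro sum.cong refl) (auto simp: algebra_simps)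
  also have "\<dots> = 2 - 2 * v $ 0"
    using m by (simp add: sum_subtractf vs sum.delta)
  \<comment> \<open>The unit length of \<open>v\<close> turns the squared norm of \<open>u\<close>
    into a multiple of its first entry.\<close>
  finally have N: "N = - 2 * u 0" by (simp add: u_def)
  \<comment> \<open>In the degenerate case both sides are zero. This identity makes the quadratic
    term of \<open>H * H\<close> cancel the two linear ones.\<close>
  have c: "c * c * N = 2 * c" by (simp add: c_def)
  have "H * H = 1\<^sub>m m"
  proof (rule eq_matI)
    fix i j assume ij: "i < dim_row (1\<^sub>m m :: real mat)" "j < dim_col (1\<^sub>m m :: real mat)"
    have "(H * H) $$ (i, j) = (\<Sum>h<m. H $$ (i, h) * H $$ (h, j))"
      using ij by (intro mult_mat_index_sum[OF H H]) auto
    also have "\<dots> = (\<Sum>h<m. (if h = i then (if i = j then 1 else 0) - c * u i * u j else 0)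
        - (if h = j then c * u i * u j else 0) + c * c * u i * u j * (u h * u h))"
      using ij by (intro sum.cong refl) (auto simp: H_def algebra_simps)
    also have "\<dots> = (if i = j then 1 else 0) - 2 * c * u i * u j + c * c * N * u i * u j"
      using ij by (simp add: sum.distrib sum_subtractf sum_distrib_left[symmetric] N_def[symmetric])
    finally show "(H * H) $$ (i, j) = 1\<^sub>m m $$ (i, j)" using ij by (simp add: c)
  qed (use H in auto)
  moreover have "col H 0 = v"
  proof (rule eq_vecI)
    fix i assume i: "i < dim_vec v"
    hence im: "i < m" using v by simp
    \<comment> \<open>If \<open>N = 0\<close>, then \<open>u\<close> vanishes and nothing is left to
      prove about the correction term. Otherwise \<open>c * u 0 = -1\<close>.\<close>
    have "u i = 0" if "N = 0"
      using that im unfolding N_def by (simp add: sum_nonneg_eq_0_iff)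
    hence "- (c * u i * u 0) = u i"
      using N by (cases "N = 0") (auto simp: c_def field_simps)
    thus "col H 0 $ i = v $ i" using im m H by (simp add: H_def u_def)
  qed (use H v in auto)
  moreover have "transpose_mat H = H" by (rule eq_matI) (auto simp: H_def)
  ultimately show ?thesis using H by blast
qed

text \<open>Deflation: a reflection \<open>H\<close> takes the first unit vector to a normalized
  eigenvector, so \<open>H * A * H\<close> has a first column, and by symmetry a first row, that is
  zero off the diagonal. The induction hypothesis diagonalizes the remaining block.\<close>

lemma symmetric_real_diagonalizable:
  assumes "(A :: real mat) \<in> carrier_mat m m" "transpose_mat A = A"
  shows "\<exists>P. orthonormal_mat m P \<and> diagonal_mat (transpose_mat P * A * P)"
  using assms
proof (induction m arbitrary: A)
  case 0
  thus ?case by (intro exI[of _ "1\<^sub>m 0"]) (auto simp: orthonormal_mat_def diagonal_mat_def)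
next
  case (Suc m A)
  note A = Suc.prems(1) and sym = Suc.prems(2)
  obtain e v0 where "eigenvector A v0 e"
    using symmetric_real_eigenvalue[OF A sym] by (auto simp: eigenvalue_def)
  hence v0: "v0 \<in> carrier_vec (Suc m)" "v0 \<noteq> 0\<^sub>v (Suc m)" "A *\<^sub>v v0 = e \<cdot>\<^sub>v v0"
    using A by (auto simp: eigenvector_def)
  have pos: "v0 \<bullet> v0 > 0"
    using conjugate_square_greater_0_vec[OF v0(1)] v0(2) by (simp add: conjugate_vec_def vec_eq_iff)
  define v where "v = (1 / sqrt (v0 \<bullet> v0)) \<cdot>\<^sub>v v0"
  have v: "v \<in> carrier_vec (Suc m)" using v0 by (simp add: v_def)
  have Av: "A *\<^sub>v v = e \<cdot>\<^sub>v v"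
    using v0 A by (simp add: v_def mult_mat_vec[of _ "Suc m" "Suc m"] smult_smult_assoc mult.commute)
  have "v \<bullet> v = 1" using pos v0 by (simp add: v_def)
  from householder[OF v this] obtain H where H: "H \<in> carrier_mat (Suc m) (Suc m)"
    and HT: "transpose_mat H = H" and HH: "H * H = 1\<^sub>m (Suc m)" and colH: "col H 0 = v" by auto
  define A' where "A' = H * A * H"
  have A': "A' \<in> carrier_mat (Suc m) (Suc m)" using H A by (simp add: A'_def)
  have A'T: "transpose_mat A' = A'"
    using H A sym HT by (simp add: A'_def transpose_mult[of _ "Suc m" "Suc m" _ "Suc m"] assoc_mult_mat[of _ "Suc m" "Suc m" _ "Suc m" _ "Suc m"])
  \<comment> \<open>With \<open>e0\<close> the first unit vector:
    \<open>H A H e0 = H A v = e H v = e H H e0 = e e0\<close>.\<close>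
  have "A' = H * (A * H)" unfolding A'_def by (rule assoc_mult_mat[OF H A H])
  hence "col A' 0 = H *\<^sub>v col (A * H) 0"
    using col_mult2[OF H mult_carrier_mat[OF A H], of 0] by simp
  also have "col (A * H) 0 = A *\<^sub>v v"
    using col_mult2[OF A H, of 0] colH by simp
  also have "H *\<^sub>v (A *\<^sub>v v) = e \<cdot>\<^sub>v (H *\<^sub>v col H 0)" using H v by (simp add: Av mult_mat_vec colH)
  also have "H *\<^sub>v col H 0 = col (H * H) 0" by (rule col_mult2[OF H H, symmetric]) simp
  also have "\<dots> = unit_vec (Suc m) 0" by (simp add: HH)
  finally have col0: "col A' 0 = e \<cdot>\<^sub>v unit_vec (Suc m) 0" .
  have c0: "A' $$ (i, 0) = (if i = 0 then e else 0)" if "i < Suc m" for i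
    using arg_cong[OF col0, of "\<lambda>x. x $ i"] that A' by (auto simp: unit_vec_def)
  have r0: "A' $$ (0, i) = (if i = 0 then e else 0)" if "i < Suc m" for i
    using c0[OF that] A'T that A' by (metis carrier_matD index_transpose_mat(1) zero_less_Suc)
  define A3 where "A3 = mat m m (\<lambda>(i,j). A' $$ (Suc i, Suc j))"
  have A3: "A3 \<in> carrier_mat m m" by (simp add: A3_def)
  have A3T: "transpose_mat A3 = A3"
  proof (rule eq_matI)
    fix i j assume "i < dim_row A3" "j < dim_col A3"
    hence ij: "Suc i < Suc m" "Suc j < Suc m" by (auto simp: A3_def)
    have "A' $$ (Suc j, Suc i) = A' $$ (Suc i, Suc j)"
      using A'T ij A' by (metis carrier_matD index_transpose_mat(1))
    thus "transpose_mat A3 $$ (i, j) = A3 $$ (i, j)" using ij by (simp add: A3_def)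
  qed (auto simp: A3_def)
  let ?E = "mat 1 1 (\<lambda>_. e) :: real mat"
  have A'b: "A' = four_block_mat ?E (0\<^sub>m 1 m) (0\<^sub>m m 1) A3"
    by (rule eq_matI) (use A' A3 in \<open>auto simp: A3_def c0 r0\<close>)
  obtain P3 where P3o: "orthonormal_mat m P3" and P3d: "diagonal_mat (transpose_mat P3 * A3 * P3)"
    using Suc.IH[OF A3 A3T] by blast
  have P3: "P3 \<in> carrier_mat m m" "transpose_mat P3 * P3 = 1\<^sub>m m" "P3 * transpose_mat P3 = 1\<^sub>m m"
    using P3o by (auto simp: orthonormal_mat_def)
  \<comment> \<open>Extends the orthogonal matrix of the smaller block so that the split-off
    coordinate stays fixed.\<close>
  define R where "R = four_block_mat (1\<^sub>m 1) (0\<^sub>m 1 m) (0\<^sub>m m 1) P3"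
  have R: "R \<in> carrier_mat (Suc m) (Suc m)" using P3 by (auto simp: R_def)
  have RT: "transpose_mat R = four_block_mat (1\<^sub>m 1) (0\<^sub>m 1 m) (0\<^sub>m m 1) (transpose_mat P3)"
    unfolding R_def by (subst transpose_four_block_mat[of _ 1 1 _ m _ m]) (use P3 in auto)
  have one: "four_block_mat (1\<^sub>m 1) (0\<^sub>m 1 m) (0\<^sub>m m 1) (1\<^sub>m m) = (1\<^sub>m (Suc m) :: real mat)"
    by (rule eq_matI) auto
  have RTR: "transpose_mat R * R = 1\<^sub>m (Suc m)"
    unfolding RT unfolding R_def by (subst mult_four_block_mat[of _ 1 1 _ m _ m _ _ 1 _ m]) (use P3 one in auto)
  have RRT: "R * transpose_mat R = 1\<^sub>m (Suc m)"
    unfolding RT unfolding R_def by (subst mult_four_block_mat[of _ 1 1 _ m _ m _ _ 1 _ m]) (use P3 one in auto)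
  have RTA: "transpose_mat R * A' = four_block_mat ?E (0\<^sub>m 1 m) (0\<^sub>m m 1) (transpose_mat P3 * A3)"
    unfolding RT A'b by (subst mult_four_block_mat[of _ 1 1 _ m _ m _ _ 1 _ m]) (use P3 A3 in auto)
  have D: "transpose_mat R * A' * R = four_block_mat ?E (0\<^sub>m 1 m) (0\<^sub>m m 1) (transpose_mat P3 * A3 * P3)"
    unfolding RTA unfolding R_def by (subst mult_four_block_mat[of _ 1 1 _ m _ m _ _ 1 _ m]) (use P3 A3 in auto)
  have diag: "diagonal_mat (transpose_mat R * A' * R)"
    unfolding D using P3d P3(1) A3 by (auto simp: diagonal_mat_def)
  define P where "P = H * R"
  note assoc = assoc_mult_mat[of _ "Suc m" "Suc m" _ "Suc m" _ "Suc m"]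
  have PT: "transpose_mat P = transpose_mat R * H"
    using H R HT by (simp add: P_def transpose_mult[of _ "Suc m" "Suc m" _ "Suc m"])
  \<comment> \<open>This and \<open>RTX\<close> are cancellation rules for products nested to the
    right, the form into which \<open>assoc\<close> rewrites.\<close>
  have HHX: "H * (H * X) = X" if "X \<in> carrier_mat (Suc m) (Suc m)" for X
    using that H by (simp add: assoc[symmetric] HH)
  have RTX: "R * (transpose_mat R * X) = X" if "X \<in> carrier_mat (Suc m) (Suc m)" for X
    using that R by (simp add: assoc[symmetric] RRT)
  have P: "P \<in> carrier_mat (Suc m) (Suc m)" using H R by (simp add: P_def)
  have "transpose_mat P * P = 1\<^sub>m (Suc m)"
    using H R by (simp add: PT, simp add: P_def assoc HHX RTR)
  moreover have "P * transpose_mat P = 1\<^sub>m (Suc m)"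
    using H R by (simp add: PT, simp add: P_def assoc RTX HH)
  moreover have "transpose_mat P * A * P = transpose_mat R * A' * R"
    using H R A by (simp add: PT, simp add: P_def A'_def assoc)
  ultimately show ?case using P diag by (auto simp: orthonormal_mat_def)
qed

text \<open>Since \<open>P\<close> is orthogonal, \<open>X = transpose_mat P * A * P\<close> amounts
  to \<open>P * X = A * P\<close>. Read column by column, this is the eigenvector equation. The
  columns have norm one, so they are nonzero as \<open>eigenvector\<close> demands.\<close>

lemma eigen_decomposition_exists:
  assumes "symmetric A"
  shows "\<exists>P \<Xi>. eigen_decomposition A P \<Xi>"
proof -
  define m where "m = dim_row A"
  have A: "A \<in> carrier_mat m m" and AT: "transpose_mat A = A"
    using assms by (auto simp: symmetric_def m_def)
  obtain P where P: "P \<in> carrier_mat m m" "transpose_mat P * P = 1\<^sub>m m" "P * transpose_mat P = 1\<^sub>m m"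
    and d: "diagonal_mat (transpose_mat P * A * P)" and o: "orthonormal_mat m P"
    using symmetric_real_diagonalizable[OF A AT] by (auto simp: orthonormal_mat_def)
  define X where "X = transpose_mat P * A * P"
  have X: "X \<in> carrier_mat m m" using A P by (simp add: X_def)
  note assoc = assoc_mult_mat[of _ m m _ m _ m]
  have "P * X = (P * transpose_mat P) * (A * P)"
    using A P(1) by (simp add: X_def assoc)
  hence PX: "P * X = A * P" using A P by simp
  have "eigenvector A (col P j) (X $$ (j, j))" if j: "j < m" for j
  proof -
    have "A *\<^sub>v col P j = P *\<^sub>v col X j"
      using j A P(1) X by (metis PX col_mult2)
    also have "\<dots> = X $$ (j, j) \<cdot>\<^sub>v col P j"
    proof (rule eq_vecI)
      fix i assume "i < dim_vec (X $$ (j, j) \<cdot>\<^sub>v col P j)"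
      hence i: "i < m" using P(1) by simp
      have "(P *\<^sub>v col X j) $ i = (\<Sum>h<m. P $$ (i, h) * X $$ (h, j))"
        using i j P(1) X by (auto simp: scalar_prod_def atLeast0LessThan intro!: sum.cong)
      also have "\<dots> = (\<Sum>h<m. if h = j then P $$ (i, j) * X $$ (j, j) else 0)"
        using d j X by (intro sum.cong refl) (auto simp: diagonal_mat_def simp flip: X_def)
      finally show "(P *\<^sub>v col X j) $ i = (X $$ (j, j) \<cdot>\<^sub>v col P j) $ i"
        using i j P(1) by simp
    qed (use P X in auto)
    finally have ev: "A *\<^sub>v col P j = X $$ (j, j) \<cdot>\<^sub>v col P j" .
    have "col P j \<bullet> col P j = (transpose_mat P * P) $$ (j, j)" using j P(1) by simp
    hence "col P j \<bullet> col P j = 1" using j P(2) by simp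
    hence "col P j \<noteq> 0\<^sub>v m" by auto
    thus ?thesis using ev A P(1) by (auto simp: eigenvector_def)
  qed
  hence "eigen_decomposition A P X"
    unfolding eigen_decomposition_def Let_def m_def[symmetric] using d o X by (simp flip: X_def)
  thus ?thesis by blast
qed

section \<open>Completing the square in the free variables\<close>

text \<open>The algebraic core, stated for functions and sums so that no matrix bookkeeping enters.
  For fixed \<open>w\<close> the form is a separable quadratic in \<open>u\<close>. It is bounded
  below iff each \<open>x l\<close> is positive, or is zero with vanishing linear coefficient
  \<open>g w l\<close>; its minimum over \<open>u\<close> is then the Schur complement form.\<close>

lemma block_form_nonneg_iff:
  fixes M D :: "nat \<Rightarrow> nat \<Rightarrow> real" and x :: "nat \<Rightarrow> real"
  shows "(\<forall>w u. (\<forall>i<k. w i \<ge> 0) \<longrightarrow>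
      0 \<le> (\<Sum>i<k. \<Sum>j<k. M i j * w i * w j) + 2 * (\<Sum>l<m. (\<Sum>i<k. D i l * w i) * u l)
           + (\<Sum>l<m. x l * (u l)\<^sup>2)) \<longleftrightarrow>
    (\<forall>l<m. x l \<ge> 0) \<and> (\<forall>i<k. \<forall>l<m. x l = 0 \<longrightarrow> D i l = 0) \<and>
    (\<forall>w. (\<forall>i<k. w i \<ge> 0) \<longrightarrow>
      0 \<le> (\<Sum>i<k. \<Sum>j<k. (M i j - (\<Sum>l | l < m \<and> x l > 0. D i l * D j l / x l)) * w i * w j))"
    (is "?L \<longleftrightarrow> ?X \<and> ?K \<and> ?S")
proof -
  let ?Q = "\<lambda>w. \<Sum>i<k. \<Sum>j<k. M i j * w i * w j"
  define g where "g w l = (\<Sum>i<k. D i l * w i)" for w l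
  define Z where "Z = {l. l < m \<and> x l > 0}"
  have Z: "finite Z" "Z \<subseteq> {..<m}" by (auto simp: Z_def)
  have schur: "(\<Sum>i<k. \<Sum>j<k. (M i j - (\<Sum>l | l < m \<and> x l > 0. D i l * D j l / x l)) * w i * w j)
      = ?Q w - (\<Sum>l\<in>Z. (g w l)\<^sup>2 / x l)" for w
  proof -
    have "(\<Sum>l\<in>Z. (g w l)\<^sup>2 / x l) = (\<Sum>l\<in>Z. \<Sum>i<k. \<Sum>j<k. D i l * D j l / x l * w i * w j)"
      unfolding g_def power2_eq_square sum_product sum_divide_distrib
      by (intro sum.cong refl) (simp add: ac_simps)
    also have "\<dots> = (\<Sum>i<k. \<Sum>l\<in>Z. \<Sum>j<k. D i l * D j l / x l * w i * w j)"
      by (rule sum.swap)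
    also have "\<dots> = (\<Sum>i<k. \<Sum>j<k. \<Sum>l\<in>Z. D i l * D j l / x l * w i * w j)"
      by (intro sum.cong refl sum.swap)
    finally show ?thesis
      by (simp add: left_diff_distrib sum_subtractf sum_distrib_right Z_def)
  qed
  have split: "2 * (\<Sum>l<m. g w l * u l) + (\<Sum>l<m. x l * (u l)\<^sup>2)
      = (\<Sum>l\<in>Z. x l * (u l + g w l / x l)\<^sup>2) - (\<Sum>l\<in>Z. (g w l)\<^sup>2 / x l)"
    if X: ?X and K: ?K for w u
  proof -
    have "2 * (\<Sum>l<m. g w l * u l) + (\<Sum>l<m. x l * (u l)\<^sup>2) = (\<Sum>l<m. 2 * g w l * u l + x l * (u l)\<^sup>2)"
      by (simp add: sum.distrib sum_distrib_left ac_simps)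
    also have "\<dots> = (\<Sum>l\<in>Z. 2 * g w l * u l + x l * (u l)\<^sup>2)"
    proof (rule sum.mono_neutral_right)
      \<comment> \<open>Outside \<open>Z\<close> the eigenvalue is zero, and \<open>?K\<close>
        removes the linear term as well.\<close>
      show "\<forall>l\<in>{..<m} - Z. 2 * g w l * u l + x l * (u l)\<^sup>2 = 0"
      proof
        fix l assume "l \<in> {..<m} - Z"
        hence l: "l < m" "x l = 0" using X by (auto simp: Z_def order.antisym)
        hence "g w l = 0" using K by (simp add: g_def)
        thus "2 * g w l * u l + x l * (u l)\<^sup>2 = 0" using l by simp
      qed
    qed (use Z in auto)
    also have "\<dots> = (\<Sum>l\<in>Z. x l * (u l + g w l / x l)\<^sup>2 - (g w l)\<^sup>2 / x l)"
      by (intro sum.cong refl) (auto simp: Z_def field_simps power2_eq_square)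
    finally show ?thesis by (simp add: sum_subtractf)
  qed
  show ?thesis unfolding schur unfolding g_def[symmetric]
  proof (intro iffI; (elim conjE)?)
    assume L: "\<forall>w u. (\<forall>i<k. w i \<ge> 0) \<longrightarrow>
      0 \<le> ?Q w + 2 * (\<Sum>l<m. g w l * u l) + (\<Sum>l<m. x l * (u l)\<^sup>2)"
    \<comment> \<open>Test with \<open>w = 0\<close> and \<open>u\<close> the \<open>l\<close>-th
      unit vector.\<close>
    have X: "x l \<ge> 0" if "l < m" for l
    proof -
      have "(\<Sum>h<m. x h * (if h = l then 1 else 0)\<^sup>2) = (\<Sum>h<m. if h = l then x l else 0)"
        by (intro sum.cong) auto
      thus ?thesis using L[rule_format, of "\<lambda>_. 0" "\<lambda>h. if h = l then 1 else 0"] that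
        by (simp add: g_def)
    qed
    have K: "D i l = 0" if il: "i < k" "l < m" "x l = 0" for i l
    proof (rule ccontr)
      assume D: "D i l \<noteq> 0"
      define w where "w j = (if j = i then 1 else 0 :: real)" for j
      \<comment> \<open>With \<open>w\<close> the \<open>i\<close>-th unit vector and
        \<open>x l = 0\<close>, the form is affine in the single nonzero coordinate \<open>t\<close>
        of \<open>u\<close>. This \<open>t\<close> solves the equation that makes its value
        \<open>-1\<close>.\<close>
      define t where "t = - (?Q w + 1) / (2 * D i l)"
      define u where "u h = (if h = l then t else 0)" for h
      have "g w l = (\<Sum>j<k. if j = i then D i l else 0)"
        unfolding g_def w_def by (intro sum.cong refl) auto
      hence gl: "g w l = D i l" using il by simp
      have "(\<Sum>h<m. g w h * u h) = (\<Sum>h<m. if h = l then g w l * t else 0)"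
        unfolding u_def by (intro sum.cong refl) auto
      hence gu: "(\<Sum>h<m. g w h * u h) = D i l * t" using il gl by simp
      have xu: "(\<Sum>h<m. x h * (u h)\<^sup>2) = 0" using il by (auto intro!: sum.neutral simp: u_def)
      have "\<forall>j<k. w j \<ge> 0" by (simp add: w_def)
      hence "0 \<le> ?Q w + 2 * (D i l * t)"
        using L[rule_format, of w u] unfolding gu xu by simp
      also have "D i l * t = - (?Q w + 1) / 2" using D unfolding t_def by simp
      also have "?Q w + 2 * (- (?Q w + 1) / 2) = -1" by argo
      finally show False by simp
    qed
    have S: "0 \<le> ?Q w - (\<Sum>l\<in>Z. (g w l)\<^sup>2 / x l)" if "\<forall>i<k. w i \<ge> 0" for w
    proof -
      \<comment> \<open>The minimizer: every completed square over \<open>Z\<close> becomes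
        zero.\<close>
      define u where "u l = - g w l / x l" for l
      have "0 \<le> ?Q w + (2 * (\<Sum>l<m. g w l * u l) + (\<Sum>l<m. x l * (u l)\<^sup>2))"
        using L[rule_format, of w u] that by simp
      also have "\<dots> = ?Q w - (\<Sum>l\<in>Z. (g w l)\<^sup>2 / x l)"
        using X K by (subst split) (auto simp: u_def)
      finally show ?thesis .
    qed
    show "?X \<and> ?K \<and> (\<forall>w. (\<forall>i<k. w i \<ge> 0) \<longrightarrow> 0 \<le> ?Q w - (\<Sum>l\<in>Z. (g w l)\<^sup>2 / x l))"
      using X K S by blast
  next
    assume X: ?X and K: ?K
      and S: "\<forall>w. (\<forall>i<k. w i \<ge> 0) \<longrightarrow> 0 \<le> ?Q w - (\<Sum>l\<in>Z. (g w l)\<^sup>2 / x l)"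
    show "\<forall>w u. (\<forall>i<k. w i \<ge> 0) \<longrightarrow>
      0 \<le> ?Q w + 2 * (\<Sum>l<m. g w l * u l) + (\<Sum>l<m. x l * (u l)\<^sup>2)"
    proof (intro allI impI)
      fix w u :: "nat \<Rightarrow> real" assume "\<forall>i<k. w i \<ge> 0"
      hence "0 \<le> ?Q w - (\<Sum>l\<in>Z. (g w l)\<^sup>2 / x l)" using S by blast
      moreover have "0 \<le> (\<Sum>l\<in>Z. x l * (u l + g w l / x l)\<^sup>2)"
        by (intro sum_nonneg) (auto simp: Z_def)
      ultimately show "0 \<le> ?Q w + 2 * (\<Sum>l<m. g w l * u l) + (\<Sum>l<m. x l * (u l)\<^sup>2)"
        using split[OF X K, of w u] by linarith
    qed
  qed
qed

section \<open>Entries of submatrices and inverses of diagonal matrices\<close>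

text \<open>Used to exchange sums over positions in a submatrix for sums over the selected
  indices.\<close>

lemma bij_betw_pick:
  assumes "finite J"
  shows "bij_betw (pick J) {..<card J} J"
proof -
  have inj: "inj_on (pick J) {..<card J}"
    by (rule inj_onI) (metis lessThan_iff linorder_neqE_nat nat_less_le pick_mono_le)
  have "pick J ` {..<card J} \<subseteq> J" by (auto intro: pick_in_set_le)
  hence "pick J ` {..<card J} = J"
    using card_image[OF inj] assms by (intro card_subset_eq) auto
  thus ?thesis using inj by (simp add: bij_betw_def)
qed

lemma submatrix_carrier_subset:
  assumes "A \<in> carrier_mat p q" "I \<subseteq> {..<p}" "J \<subseteq> {..<q}"
  shows "submatrix A I J \<in> carrier_mat (card I) (card J)"
    and "\<And>i j. i < card I \<Longrightarrow> j < card J \<Longrightarrow> submatrix A I J $$ (i, j) = A $$ (pick I i, pick J j)"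
proof -
  have "{i. i < p \<and> i \<in> I} = I" "{j. j < q \<and> j \<in> J} = J" using assms by auto
  thus "submatrix A I J \<in> carrier_mat (card I) (card J)"
    and "\<And>i j. i < card I \<Longrightarrow> j < card J \<Longrightarrow> submatrix A I J $$ (i, j) = A $$ (pick I i, pick J j)"
    using assms(1) by (auto simp: submatrix_def)
qed

text \<open>\<open>UNIV\<close> is not contained in \<open>{..<p}\<close>, so the preceding lemma
  does not apply to its rows; \<open>pick UNIV\<close> leaves row numbers unchanged.\<close>

lemma submatrix_UNIV_rows:
  assumes "A \<in> carrier_mat p q" "J \<subseteq> {..<q}"
  shows "submatrix A UNIV J \<in> carrier_mat p (card J)"
    and "\<And>i j. i < p \<Longrightarrow> j < card J \<Longrightarrow> submatrix A UNIV J $$ (i, j) = A $$ (i, pick J j)"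
proof -
  have "{j. j < q \<and> j \<in> J} = J" using assms by auto
  thus "submatrix A UNIV J \<in> carrier_mat p (card J)"
    and "\<And>i j. i < p \<Longrightarrow> j < card J \<Longrightarrow> submatrix A UNIV J $$ (i, j) = A $$ (i, pick J j)"
    using assms(1) by (auto simp: submatrix_def pick_UNIV)
qed

text \<open>\<open>mat_inverse\<close> returns an option. The entrywise reciprocal \<open>Y\<close>
  shows that \<open>X\<close> is a unit, so some inverse \<open>B\<close> is returned, and
  \<open>B = B * (X * Y) = (B * X) * Y = Y\<close>.\<close>

lemma mat_inverse_diagonal:
  fixes X :: "'a :: field mat"
  assumes X: "X \<in> carrier_mat p p" and d: "diagonal_mat X" and nz: "\<And>l. l < p \<Longrightarrow> X $$ (l, l) \<noteq> 0"
  shows "the (mat_inverse X) = mat p p (\<lambda>(i, j). if i = j then 1 / X $$ (i, i) else 0)"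
proof -
  define Y where "Y = mat p p (\<lambda>(i, j). if i = j then 1 / X $$ (i, i) else 0)"
  have Y: "Y \<in> carrier_mat p p" by (simp add: Y_def)
  have XY: "X * Y = 1\<^sub>m p"
  proof (rule eq_matI)
    fix i j assume ij: "i < dim_row (1\<^sub>m p :: 'a mat)" "j < dim_col (1\<^sub>m p :: 'a mat)"
    have "(X * Y) $$ (i, j) = (\<Sum>h<p. X $$ (i, h) * Y $$ (h, j))"
      using ij X Y by (auto simp: scalar_prod_def atLeast0LessThan intro!: sum.cong)
    also have "\<dots> = (\<Sum>h<p. if h = i then (if i = j then 1 else 0) else 0)"
      using ij d X nz by (intro sum.cong refl) (auto simp: Y_def diagonal_mat_def)
    finally show "(X * Y) $$ (i, j) = 1\<^sub>m p $$ (i, j)" using ij by simp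
  qed (use X Y in auto)
  have YX: "Y * X = 1\<^sub>m p" using mat_mult_left_right_inverse[OF X Y XY] .
  have "X \<in> Units (ring_mat TYPE('a) p ())"
    using X Y XY YX by (auto simp: Units_def ring_mat_def)
  then obtain B where B: "mat_inverse X = Some B" using mat_inverse(1)[OF X, of "()"] by blast
  hence BX: "B * X = 1\<^sub>m p" "B \<in> carrier_mat p p" using mat_inverse(2)[OF X B] by auto
  have "B * (X * Y) = (B * X) * Y" by (rule assoc_mult_mat[symmetric, OF BX(2) X Y])
  hence "B = Y" using BX XY Y by simp
  thus ?thesis using B by (simp add: Y_def)
qed

section \<open>Quadratic forms in eigenvector coordinates\<close>

lemma quad_form_congruence:
  assumes A: "A \<in> carrier_mat m m" and P: "P \<in> carrier_mat m m" and u: "u \<in> carrier_vec m"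
  shows "quad_form A (P *\<^sub>v u) = quad_form (transpose_mat P * A * P) u"
proof -
  have "quad_form (transpose_mat P * A * P) u = u \<bullet> (transpose_mat P *\<^sub>v (A *\<^sub>v (P *\<^sub>v u)))"
    using A P u by (simp add: quad_form_def assoc_mult_mat_vec[of _ m m _ m])
  also have "\<dots> = (P *\<^sub>v u) \<bullet> (A *\<^sub>v (P *\<^sub>v u))"
    using transpose_vec_mult_scalar[OF P u, of "A *\<^sub>v (P *\<^sub>v u)"] A P u
    by (metis (no_types, lifting) comm_scalar_prod mult_mat_vec_carrier transpose_carrier_mat)
  finally show ?thesis by (simp add: quad_form_def)
qed

lemma quad_form_diagonal:
  assumes "X \<in> carrier_mat m m" "diagonal_mat X" "u \<in> carrier_vec m"
  shows "quad_form X u = (\<Sum>l<m. X $$ (l, l) * (u $ l)\<^sup>2)"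
proof -
  have "(\<Sum>j<m. X $$ (i, j) * u $ i * u $ j) = (\<Sum>j<m. if j = i then X $$ (i, i) * (u $ i)\<^sup>2 else 0)"
    if "i < m" for i
    using that assms by (intro sum.cong refl) (auto simp: diagonal_mat_def power2_eq_square)
  thus ?thesis using assms by (simp add: quad_form_sum)
qed

text \<open>The last two facts make \<open>P\<close> a change of variables: it diagonalizes the
  form, and it reaches every vector \<open>z\<close>, with coordinates
  \<open>transpose_mat P *\<^sub>v z\<close>.\<close>

lemma eigen_decompositionD:
  fixes u z :: "real vec"
  assumes "eigen_decomposition A P X" "A \<in> carrier_mat m m"
  shows "P \<in> carrier_mat m m" "X \<in> carrier_mat m m" "diagonal_mat X"
    and "u \<in> carrier_vec m \<Longrightarrow> quad_form A (P *\<^sub>v u) = (\<Sum>l<m. X $$ (l, l) * (u $ l)\<^sup>2)"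
    and "z \<in> carrier_vec m \<Longrightarrow> P *\<^sub>v (transpose_mat P *\<^sub>v z) = z"
proof -
  show P: "P \<in> carrier_mat m m" and X: "X \<in> carrier_mat m m" and d: "diagonal_mat X"
    using assms by (auto simp: eigen_decomposition_def orthonormal_mat_def Let_def)
  have PAP: "transpose_mat P * A * P = X" and PP: "P * transpose_mat P = 1\<^sub>m m"
    using assms by (auto simp: eigen_decomposition_def orthonormal_mat_def Let_def)
  show "quad_form A (P *\<^sub>v u) = (\<Sum>l<m. X $$ (l, l) * (u $ l)\<^sup>2)" if "u \<in> carrier_vec m"
    using quad_form_congruence[OF assms(2) P that] quad_form_diagonal[OF X d that] PAP by simp
  show "P *\<^sub>v (transpose_mat P *\<^sub>v z) = z" if "z \<in> carrier_vec m"
    using P PP that by (simp add: assoc_mult_mat_vec[of _ m m _ m, symmetric])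
qed

text \<open>The form takes the value \<open>X $$ (l, l)\<close> at the \<open>l\<close>-th column of
  \<open>P\<close>, and at any vector it is a combination of these values with squares as
  coefficients.\<close>

lemma pos_semidef_iff_eigenvalues:
  assumes dec: "eigen_decomposition A P X" and A: "A \<in> carrier_mat m m" "symmetric A"
  shows "pos_semidef A \<longleftrightarrow> (\<forall>l<m. X $$ (l, l) \<ge> 0)"
proof
  note D = eigen_decompositionD[OF dec A(1)]
  show "\<forall>l<m. X $$ (l, l) \<ge> 0" if psd: "pos_semidef A"
  proof (intro allI impI)
    fix l assume l: "l < m"
    have "(\<Sum>h<m. X $$ (h, h) * (unit_vec m l $ h)\<^sup>2) = (\<Sum>h<m. if h = l then X $$ (l, l) else 0)"
      using l by (intro sum.cong refl) (auto simp: unit_vec_def)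
    hence "quad_form A (P *\<^sub>v unit_vec m l) = X $$ (l, l)"
      using D(4)[of "unit_vec m l"] l by simp
    moreover have "quad_form A (P *\<^sub>v unit_vec m l) \<ge> 0"
      using psd A D(1) by (auto simp: pos_semidef_def)
    ultimately show "X $$ (l, l) \<ge> 0" by simp
  qed
  show "pos_semidef A" if X: "\<forall>l<m. X $$ (l, l) \<ge> 0"
    unfolding pos_semidef_def
  proof (intro conjI ballI A(2))
    fix z :: "real vec" assume "z \<in> carrier_vec (dim_row A)"
    hence z: "z \<in> carrier_vec m" using A by simp
    have "quad_form A z = (\<Sum>l<m. X $$ (l, l) * ((transpose_mat P *\<^sub>v z) $ l)\<^sup>2)"
      using D(4)[of "transpose_mat P *\<^sub>v z"] D(5)[OF z] D(1) z by simp
    thus "quad_form A z \<ge> 0" using X by (auto intro!: sum_nonneg)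
  qed
qed

lemma symmetric_index:
  assumes "symmetric A" "A \<in> carrier_mat m m" "i < m" "j < m"
  shows "A $$ (i, j) = A $$ (j, i)"
  using assms by (metis carrier_matD index_transpose_mat(1) symmetric_def)

lemma symmetricI:
  assumes "A \<in> carrier_mat m m" "\<And>i j. i < m \<Longrightarrow> j < m \<Longrightarrow> A $$ (i, j) = A $$ (j, i)"
  shows "symmetric A"
  using assms unfolding symmetric_def by (auto intro!: eq_matI)

section \<open>The quadratic form on a cone of sign conditions\<close>

text \<open>Abstracts from \<open>b\<close> and \<alpha>: what follows speaks only of three pairwise
  disjoint index sets, which may leave out some indices below \<open>n\<close>.\<close>

locale signed_blocks =
  fixes n :: nat and Q :: "real mat" and Jp Jm Jf :: "nat set"
  assumes Q: "Q \<in> carrier_mat n n" "symmetric Q"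
    and subsets: "Jp \<subseteq> {..<n}" "Jm \<subseteq> {..<n}" "Jf \<subseteq> {..<n}"
    and disjoint: "Jp \<inter> Jm = {}" "(Jp \<union> Jm) \<inter> Jf = {}"
begin

text \<open>The rows of the block matrices are those of \<open>Jp\<close> followed by those of \<open>Jm\<close>; the sign turns
  a variable that is nonpositive on \<open>Jm\<close> into a nonnegative one.\<close>

definition idx :: "nat \<Rightarrow> nat" where
  "idx i = (if i < card Jp then pick Jp i else pick Jm (i - card Jp))"

definition sg :: "nat \<Rightarrow> real" where
  "sg i = (if i < card Jp then 1 else -1)"

text \<open>The signs cancel within a diagonal block and give a minus sign across blocks, so this is
  the block matrix from which the Schur complement subtracts.\<close>

definition M :: "nat \<Rightarrow> nat \<Rightarrow> real" where
  "M i j = sg i * sg j * Q $$ (idx i, idx j)"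

definition C :: "nat \<Rightarrow> nat \<Rightarrow> real" where
  "C i h = sg i * Q $$ (idx i, pick Jf h)"

text \<open>The coupling of signed variables with eigenvector coordinates. Its columns at zero
  eigenvalues belong to the kernel condition, those at positive eigenvalues to the Schur
  complement.\<close>

definition D :: "real mat \<Rightarrow> nat \<Rightarrow> nat \<Rightarrow> real" where
  "D P i l = (\<Sum>h<card Jf. C i h * P $$ (h, l))"

text \<open>For the index sets of the quadratic program this is the feasible set, by
  \<open>feasible_eq\<close>.\<close>

definition cone :: "real vec set" where
  "cone = {v \<in> carrier_vec n. (\<forall>s\<in>Jp. v $ s \<ge> 0) \<and> (\<forall>s\<in>Jm. v $ s \<le> 0) \<and>
     (\<forall>s<n. s \<notin> Jp \<union> Jm \<union> Jf \<longrightarrow> v $ s = 0)}"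

abbreviation "k \<equiv> card Jp + card Jm"
abbreviation "Qff \<equiv> submatrix Q Jf Jf"

lemma fin: "finite Jp" "finite Jm" "finite Jf"
  using subsets finite_subset by blast+

lemma card_k: "card (Jp \<union> Jm) = k"
  using fin disjoint by (simp add: card_Un_disjoint)

lemma sg_sq [simp]: "sg i * sg i = 1"
  by (simp add: sg_def)

lemma bij_idx: "bij_betw idx {..<k} (Jp \<union> Jm)"
proof -
  have split: "{..<k} = {..<card Jp} \<union> (\<lambda>i. i + card Jp) ` {..<card Jm}"
  proof (rule Set.set_eqI)
    fix i show "i \<in> {..<k} \<longleftrightarrow> i \<in> {..<card Jp} \<union> (\<lambda>i. i + card Jp) ` {..<card Jm}"
      by (cases "i < card Jp") (auto intro!: image_eqI[of _ _ "i - card Jp"])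
  qed
  have "idx ` {..<k} = pick Jp ` {..<card Jp} \<union> pick Jm ` {..<card Jm}"
    unfolding split image_Un image_image by (auto simp: idx_def)
  also have "\<dots> = Jp \<union> Jm"
    using bij_betw_pick[OF fin(1)] bij_betw_pick[OF fin(2)] by (simp add: bij_betw_def)
  finally have im: "idx ` {..<k} = Jp \<union> Jm" .
  moreover have "inj_on idx {..<k}"
    by (rule eq_card_imp_inj_on) (simp_all add: im card_k)
  ultimately show ?thesis by (simp add: bij_betw_def)
qed

lemma bij_free: "bij_betw (pick Jf) {..<card Jf} Jf"
  by (rule bij_betw_pick[OF fin(3)])

lemma idx_less: "i < k \<Longrightarrow> idx i < n"
  using bij_idx subsets by (auto simp: bij_betw_def)

lemma idx_cases: "i < k \<Longrightarrow> (sg i = 1 \<and> idx i \<in> Jp) \<or> (sg i = -1 \<and> idx i \<in> Jm)"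
  by (auto simp: idx_def sg_def intro!: pick_in_set_le)

lemma free_less: "h < card Jf \<Longrightarrow> pick Jf h < n"
  using bij_free subsets by (auto simp: bij_betw_def)

lemma Qff: "Qff \<in> carrier_mat (card Jf) (card Jf)" "symmetric Qff"
proof -
  show *: "Qff \<in> carrier_mat (card Jf) (card Jf)"
    by (rule submatrix_carrier_subset[OF Q(1) subsets(3) subsets(3)])
  show "symmetric Qff"
    using submatrix_carrier_subset(2)[OF Q(1) subsets(3) subsets(3)] symmetric_index[OF Q(2,1)] free_less
    by (intro symmetricI[OF *]) auto
qed

text \<open>Because \<open>v\<close> vanishes off the three index sets, the double sum splits into
  four. Symmetry of \<open>Q\<close> merges the two mixed sums, and \<open>sg i * sg i = 1\<close>
  absorbs the sign changes.\<close>

lemma quad_form_blocks: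
  assumes v: "v \<in> carrier_vec n" and z0: "\<forall>s<n. s \<notin> Jp \<union> Jm \<union> Jf \<longrightarrow> v $ s = 0"
  defines "w \<equiv> \<lambda>i. sg i * v $ idx i" and "z \<equiv> vec (card Jf) (\<lambda>h. v $ pick Jf h)"
  shows "quad_form Q v = (\<Sum>i<k. \<Sum>j<k. M i j * w i * w j)
     + 2 * (\<Sum>i<k. \<Sum>h<card Jf. C i h * w i * z $ h) + quad_form Qff z"
proof -
  let ?N = "Jp \<union> Jm" and ?q = "\<lambda>s t. Q $$ (s, t) * v $ s * v $ t"
  have dec: "(\<Sum>s<n. f s) = (\<Sum>s\<in>?N. f s) + (\<Sum>s\<in>Jf. f s)"
    if "\<And>s. s < n \<Longrightarrow> v $ s = 0 \<Longrightarrow> f s = 0" for f :: "nat \<Rightarrow> real"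
  proof -
    have "(\<Sum>s<n. f s) = (\<Sum>s\<in>?N \<union> Jf. f s)"
      using z0 that subsets by (intro sum.mono_neutral_right) auto
    thus ?thesis using fin disjoint by (simp add: sum.union_disjoint)
  qed
  have "quad_form Q v = (\<Sum>s<n. \<Sum>t<n. ?q s t)" by (rule quad_form_sum[OF Q(1) v])
  also have "\<dots> = (\<Sum>s<n. (\<Sum>t\<in>?N. ?q s t) + (\<Sum>t\<in>Jf. ?q s t))"
    by (intro sum.cong refl dec) auto
  also have "\<dots> = (\<Sum>s<n. \<Sum>t\<in>?N. ?q s t) + (\<Sum>s<n. \<Sum>t\<in>Jf. ?q s t)"
    by (rule sum.distrib)
  also have "(\<Sum>s<n. \<Sum>t\<in>?N. ?q s t) = (\<Sum>s\<in>?N. \<Sum>t\<in>?N. ?q s t) + (\<Sum>s\<in>Jf. \<Sum>t\<in>?N. ?q s t)"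
    by (rule dec) simp
  also have "(\<Sum>s<n. \<Sum>t\<in>Jf. ?q s t) = (\<Sum>s\<in>?N. \<Sum>t\<in>Jf. ?q s t) + (\<Sum>s\<in>Jf. \<Sum>t\<in>Jf. ?q s t)"
    by (rule dec) simp
  also have "(\<Sum>s\<in>Jf. \<Sum>t\<in>?N. ?q s t) = (\<Sum>s\<in>?N. \<Sum>t\<in>Jf. ?q s t)"
  proof (subst sum.swap, intro sum.cong refl)
    fix s t assume "s \<in> ?N" "t \<in> Jf"
    hence "s < n" "t < n" using subsets by auto
    thus "?q t s = ?q s t" using symmetric_index[OF Q(2,1), of s t] by simp
  qed
  finally have sum: "quad_form Q v = (\<Sum>s\<in>?N. \<Sum>t\<in>?N. ?q s t) + 2 * (\<Sum>s\<in>?N. \<Sum>t\<in>Jf. ?q s t)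
      + (\<Sum>s\<in>Jf. \<Sum>t\<in>Jf. ?q s t)" by simp
  have q1: "M i j * w i * w j = ?q (idx i) (idx j)" for i j
  proof -
    have "M i j * w i * w j = (sg i * sg i) * (sg j * sg j) * ?q (idx i) (idx j)"
      unfolding M_def w_def by (simp only: ac_simps)
    thus ?thesis by simp
  qed
  have q2: "C i h * w i * z $ h = ?q (idx i) (pick Jf h)" if "h < card Jf" for i h
  proof -
    have "C i h * w i * z $ h = (sg i * sg i) * ?q (idx i) (pick Jf h)"
      unfolding C_def w_def using that by (simp add: z_def)
    thus ?thesis by simp
  qed
  have s1: "(\<Sum>s\<in>?N. \<Sum>t\<in>?N. ?q s t) = (\<Sum>i<k. \<Sum>j<k. M i j * w i * w j)"
    unfolding q1 by (simp only: sum.reindex_bij_betw[OF bij_idx, symmetric])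
  have s2: "(\<Sum>s\<in>?N. \<Sum>t\<in>Jf. ?q s t) = (\<Sum>i<k. \<Sum>h<card Jf. C i h * w i * z $ h)"
    by (simp add: q2 sum.reindex_bij_betw[OF bij_idx, symmetric] sum.reindex_bij_betw[OF bij_free, symmetric])
  have "quad_form Qff z = (\<Sum>h<card Jf. \<Sum>h'<card Jf. ?q (pick Jf h) (pick Jf h'))"
    using submatrix_carrier_subset(2)[OF Q(1) subsets(3) subsets(3)]
    by (subst quad_form_sum[OF Qff(1)]) (auto simp: z_def)
  hence s3: "(\<Sum>s\<in>Jf. \<Sum>t\<in>Jf. ?q s t) = quad_form Qff z"
    by (simp only: sum.reindex_bij_betw[OF bij_free, symmetric])
  show ?thesis unfolding sum s1 s2 s3 ..
qed

context
  fixes P X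
  assumes dec: "eigen_decomposition Qff P X"
begin

lemmas decD = eigen_decompositionD[OF dec Qff(1)]

text \<open>Substituting \<open>P *\<^sub>v u\<close> for the free part turns \<open>C\<close> into
  \<open>D P\<close> after exchanging sums. The coordinates are tied to \<open>v\<close> by
  equations, since one use builds \<open>v\<close> from them and the other reads them off
  \<open>v\<close>.\<close>

lemma quad_form_eigen_coords:
  assumes v: "v \<in> carrier_vec n" and z0: "\<forall>s<n. s \<notin> Jp \<union> Jm \<union> Jf \<longrightarrow> v $ s = 0"
    and w: "\<forall>i<k. v $ idx i = sg i * w i"
    and u: "u \<in> carrier_vec (card Jf)" and vu: "vec (card Jf) (\<lambda>h. v $ pick Jf h) = P *\<^sub>v u"
  shows "quad_form Q v = (\<Sum>i<k. \<Sum>j<k. M i j * w i * w j)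
     + 2 * (\<Sum>l<card Jf. (\<Sum>i<k. D P i l * w i) * u $ l) + (\<Sum>l<card Jf. X $$ (l, l) * (u $ l)\<^sup>2)"
proof -
  have w': "sg i * v $ idx i = w i" if "i < k" for i
    using w that by (simp add: mult.assoc[symmetric])
  have Pu: "(P *\<^sub>v u) $ h = (\<Sum>l<card Jf. P $$ (h, l) * u $ l)" if "h < card Jf" for h
    using that u decD(1) by (auto simp: scalar_prod_def atLeast0LessThan intro!: sum.cong)
  have "(\<Sum>i<k. \<Sum>h<card Jf. C i h * w i * (P *\<^sub>v u) $ h)
      = (\<Sum>i<k. \<Sum>h<card Jf. \<Sum>l<card Jf. C i h * P $$ (h, l) * w i * u $ l)"
    by (intro sum.cong refl) (simp add: Pu sum_distrib_left ac_simps)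
  also have "\<dots> = (\<Sum>i<k. \<Sum>l<card Jf. \<Sum>h<card Jf. C i h * P $$ (h, l) * w i * u $ l)"
    by (intro sum.cong refl sum.swap)
  also have "\<dots> = (\<Sum>l<card Jf. \<Sum>i<k. \<Sum>h<card Jf. C i h * P $$ (h, l) * w i * u $ l)"
    by (rule sum.swap)
  also have "\<dots> = (\<Sum>l<card Jf. (\<Sum>i<k. D P i l * w i) * u $ l)"
    by (simp add: D_def sum_distrib_right)
  finally show ?thesis
    unfolding quad_form_blocks[OF v z0] vu decD(4)[OF u] by (simp add: w')
qed

text \<open>Points of the cone correspond to pairs of a nonnegative \<open>w\<close> and an
  unrestricted \<open>u\<close>, because the signs are invertible and so is
  \<open>P\<close>.\<close>

lemma quad_form_nonneg_on_cone_iff: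
  "(\<forall>v\<in>cone. 0 \<le> quad_form Q v) \<longleftrightarrow>
   (\<forall>w u. (\<forall>i<k. w i \<ge> 0) \<longrightarrow> 0 \<le> (\<Sum>i<k. \<Sum>j<k. M i j * w i * w j)
     + 2 * (\<Sum>l<card Jf. (\<Sum>i<k. D P i l * w i) * u l) + (\<Sum>l<card Jf. X $$ (l, l) * (u l)\<^sup>2))"
  (is "?L \<longleftrightarrow> ?R")
proof
  assume L: ?L
  show ?R
  proof (intro allI impI)
    fix w u :: "nat \<Rightarrow> real" assume w: "\<forall>i<k. w i \<ge> 0"
    define z where "z = P *\<^sub>v vec (card Jf) u"
    \<comment> \<open>Undoes the numbering of both index groups and restores the original
      signs.\<close>
    define v where "v = vec n (\<lambda>s.
      if s \<in> Jp \<union> Jm then sg (the_inv_into {..<k} idx s) * w (the_inv_into {..<k} idx s)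
      else if s \<in> Jf then z $ the_inv_into {..<card Jf} (pick Jf) s else 0)"
    have vi: "\<forall>i<k. v $ idx i = sg i * w i"
      using bij_idx idx_less by (auto simp: v_def bij_betw_def the_inv_into_f_f)
    have vf: "v $ pick Jf h = z $ h" if "h < card Jf" for h
    proof -
      have "pick Jf h \<in> Jf" using that by (rule pick_in_set_le)
      thus ?thesis
        using that bij_free free_less[OF that] disjoint by (auto simp: v_def bij_betw_def the_inv_into_f_f)
    qed
    have vz: "vec (card Jf) (\<lambda>h. v $ pick Jf h) = z"
      using decD(1) by (intro eq_vecI) (auto simp: vf z_def)
    have v: "v \<in> carrier_vec n" by (simp add: v_def)
    have v0: "\<forall>s<n. s \<notin> Jp \<union> Jm \<union> Jf \<longrightarrow> v $ s = 0" by (simp add: v_def)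
    have idx_img: "\<exists>i<k. s = idx i" if "s \<in> Jp \<union> Jm" for s
      using that bij_idx by (auto simp: bij_betw_def)
    have "v $ s \<ge> 0" if s: "s \<in> Jp" for s
    proof -
      obtain i where i: "i < k" "s = idx i" using idx_img s by blast
      hence "sg i = 1" using idx_cases[OF i(1)] s disjoint by auto
      thus ?thesis using vi w i by simp
    qed
    moreover have "v $ s \<le> 0" if s: "s \<in> Jm" for s
    proof -
      obtain i where i: "i < k" "s = idx i" using idx_img s by blast
      hence "sg i = -1" using idx_cases[OF i(1)] s disjoint by auto
      thus ?thesis using vi w i by simp
    qed
    ultimately have "v \<in> cone" using v v0 by (auto simp: cone_def)
    hence "0 \<le> quad_form Q v" using L by blast
    also have "\<dots> = (\<Sum>i<k. \<Sum>j<k. M i j * w i * w j)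
       + 2 * (\<Sum>l<card Jf. (\<Sum>i<k. D P i l * w i) * vec (card Jf) u $ l)
       + (\<Sum>l<card Jf. X $$ (l, l) * (vec (card Jf) u $ l)\<^sup>2)"
      by (rule quad_form_eigen_coords[OF v v0 vi]) (auto simp: vz z_def)
    finally show "0 \<le> (\<Sum>i<k. \<Sum>j<k. M i j * w i * w j)
       + 2 * (\<Sum>l<card Jf. (\<Sum>i<k. D P i l * w i) * u l) + (\<Sum>l<card Jf. X $$ (l, l) * (u l)\<^sup>2)"
      by simp
  qed
next
  assume R: ?R
  show ?L
  proof
    fix v assume vc: "v \<in> cone"
    hence v: "v \<in> carrier_vec n" and v0: "\<forall>s<n. s \<notin> Jp \<union> Jm \<union> Jf \<longrightarrow> v $ s = 0"
      by (auto simp: cone_def)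
    define z where "z = vec (card Jf) (\<lambda>h. v $ pick Jf h)"
    define u where "u = transpose_mat P *\<^sub>v z"
    have z: "z \<in> carrier_vec (card Jf)" by (simp add: z_def)
    have u: "u \<in> carrier_vec (card Jf)" using decD(1) by (simp add: u_def z)
    have zu: "z = P *\<^sub>v u" unfolding u_def by (rule decD(5)[OF z, symmetric])
    define w where "w i = sg i * v $ idx i" for i
    have w: "w i \<ge> 0" if "i < k" for i
      using idx_cases[OF that] vc by (auto simp: w_def cone_def)
    have "\<forall>i<k. v $ idx i = sg i * w i" by (simp add: w_def mult.assoc[symmetric])
    from quad_form_eigen_coords[OF v v0 this u zu[unfolded z_def]]
    show "0 \<le> quad_form Q v" using R w by simp
  qed
qed

section \<open>The kernel condition and the Schur complement entry by entry\<close>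

lemma pos_eigs_eq: "pos_eigs X = {l. l < card Jf \<and> X $$ (l, l) > 0}"
  and zero_eigs_eq: "zero_eigs X = {l. l < card Jf \<and> X $$ (l, l) = 0}"
  using decD(2) by (auto simp: pos_eigs_def zero_eigs_def)

text \<open>The rows of \<open>Jm\<close> carry no minus sign in \<open>kernel_condition\<close> but
  do in \<open>D\<close>. Vanishing of an entry is unaffected, as \<open>sg i\<close> is never
  zero.\<close>

lemma kernel_condition_iff:
  "kernel_condition Q Jp Jm Jf P X \<longleftrightarrow> (\<forall>i<k. \<forall>l<card Jf. X $$ (l, l) = 0 \<longrightarrow> D P i l = 0)"
proof -
  let ?Z = "zero_eigs X"
  define A where "A = submatrix Q Jp Jf @\<^sub>r submatrix Q Jm Jf"
  define B where "B = submatrix P UNIV ?Z"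
  note sp = submatrix_carrier_subset[OF Q(1) subsets(1) subsets(3)]
    and sm = submatrix_carrier_subset[OF Q(1) subsets(2) subsets(3)]
  have Zs: "?Z \<subseteq> {..<card Jf}" by (auto simp: zero_eigs_eq)
  note sP = submatrix_UNIV_rows[OF decD(1) Zs]
  have A: "A \<in> carrier_mat k (card Jf)" unfolding A_def using sp(1) sm(1) by (rule carrier_append_rows)
  have B: "B \<in> carrier_mat (card Jf) (card ?Z)" unfolding B_def by (rule sP)
  have Ai: "A $$ (i, h) = sg i * C i h" if "i < k" "h < card Jf" for i h
    using that sp sm by (auto simp: A_def append_rows_def C_def idx_def sg_def)
  have AB: "(A * B) $$ (i, l) = sg i * D P i (pick ?Z l)" if "i < k" "l < card ?Z" for i l
    using mult_mat_index_sum[OF A B that] that sP(2)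
    by (simp add: Ai B_def D_def sum_distrib_left mult.assoc)
  have sg0: "sg i \<noteq> 0" for i by (simp add: sg_def)
  have "kernel_condition Q Jp Jm Jf P X \<longleftrightarrow> A * B = 0\<^sub>m k (card ?Z)"
    by (simp add: kernel_condition_def A_def B_def)
  also have "\<dots> \<longleftrightarrow> (\<forall>i<k. \<forall>l<card ?Z. (A * B) $$ (i, l) = 0)"
    using A B by (auto simp: mat_eq_iff)
  also have "\<dots> \<longleftrightarrow> (\<forall>i<k. \<forall>l\<in>{..<card ?Z}. D P i (pick ?Z l) = 0)"
    by (auto simp: AB sg0)
  also have "\<dots> \<longleftrightarrow> (\<forall>i<k. \<forall>l\<in>?Z. D P i l = 0)"
  proof -
    have "pick ?Z ` {..<card ?Z} = ?Z"
      using bij_betw_pick[OF finite_subset[OF Zs]] by (simp add: bij_betw_def)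
    thus ?thesis by (metis (no_types, lifting) image_iff)
  qed
  finally show ?thesis by (auto simp: zero_eigs_eq)
qed

text \<open>The selected eigenvalue block is diagonal with positive entries, so multiplying by its
  inverse divides each column by its eigenvalue. Reindexing along \<open>pick\<close> then gives a
  sum over the positive eigenvalues.\<close>

lemma schur_complement_entries:
  defines "S \<equiv> schur_complement Q Jp Jm Jf P X"
  shows "S \<in> carrier_mat k k"
    and "\<And>i j. i < k \<Longrightarrow> j < k \<Longrightarrow> S $$ (i, j)
      = M i j - (\<Sum>l | l < card Jf \<and> X $$ (l, l) > 0. D P i l * D P j l / X $$ (l, l))"
proof -
  let ?Z = "pos_eigs X"
  define p where "p = card ?Z"
  define Pp where "Pp = submatrix P UNIV ?Z"
  define Xp where "Xp = submatrix X ?Z ?Z"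
  define B where "B = (submatrix Q Jp Jf * Pp) @\<^sub>r (- (submatrix Q Jm Jf * Pp))"
  define F where "F = four_block_mat (submatrix Q Jp Jp) (- submatrix Q Jp Jm)
           (- submatrix Q Jm Jp) (submatrix Q Jm Jm)"
  define Y where "Y = mat p p (\<lambda>(i, j). if i = j then 1 / Xp $$ (i, i) else 0)"
  note sp = submatrix_carrier_subset[OF Q(1) subsets(1) subsets(3)]
    and sm = submatrix_carrier_subset[OF Q(1) subsets(2) subsets(3)]
    and spp = submatrix_carrier_subset[OF Q(1) subsets(1) subsets(1)]
    and spm = submatrix_carrier_subset[OF Q(1) subsets(1) subsets(2)]
    and smp = submatrix_carrier_subset[OF Q(1) subsets(2) subsets(1)]
    and smm = submatrix_carrier_subset[OF Q(1) subsets(2) subsets(2)]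
  have Zs: "?Z \<subseteq> {..<card Jf}" by (auto simp: pos_eigs_eq)
  have bijZ: "bij_betw (pick ?Z) {..<p} ?Z"
    unfolding p_def by (rule bij_betw_pick[OF finite_subset[OF Zs]]) simp
  have pZ: "pick ?Z l \<in> ?Z" if "l < p" for l using that by (auto simp: p_def intro: pick_in_set_le)
  note sP = submatrix_UNIV_rows[OF decD(1) Zs, folded p_def Pp_def]
  note sX = submatrix_carrier_subset[OF decD(2) Zs Zs, folded p_def Xp_def]
  have dX: "diagonal_mat Xp"
    unfolding diagonal_mat_def
  proof (intro allI impI)
    fix i j assume "i < dim_row Xp" "j < dim_col Xp" "i \<noteq> j"
    hence ij: "i < p" "j < p" "i \<noteq> j" using sX(1) by auto
    \<comment> \<open>Distinct positions select distinct indices, so off-diagonal entries of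
      \<open>Xp\<close> come from off-diagonal entries of \<open>X\<close>.\<close>
    hence "pick ?Z i \<noteq> pick ?Z j" using bijZ by (auto simp: bij_betw_def inj_on_def)
    moreover have "pick ?Z i < card Jf" "pick ?Z j < card Jf" using pZ ij Zs by auto
    ultimately show "Xp $$ (i, j) = 0"
      using decD(2,3) ij by (auto simp: sX diagonal_mat_def)
  qed
  have Xpos: "Xp $$ (l, l) > 0" if "l < p" for l
    using pZ[OF that] that by (simp add: sX pos_eigs_def)
  have Y: "Y \<in> carrier_mat p p" by (simp add: Y_def)
  have inv: "the (mat_inverse Xp) = Y"
    unfolding Y_def by (rule mat_inverse_diagonal[OF sX(1) dX]) (use Xpos in force)
  have Bc1: "submatrix Q Jp Jf * Pp \<in> carrier_mat (card Jp) p" using sp(1) sP(1) by simp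
  have Bc2: "- (submatrix Q Jm Jf * Pp) \<in> carrier_mat (card Jm) p" using sm(1) sP(1) by simp
  have B: "B \<in> carrier_mat k p" unfolding B_def using Bc1 Bc2 by (rule carrier_append_rows)
  have Bi: "B $$ (i, l) = D P i (pick ?Z l)" if il: "i < k" "l < p" for i l
  proof (cases "i < card Jp")
    case True
    have "B $$ (i, l) = (submatrix Q Jp Jf * Pp) $$ (i, l)"
      using True il Bc1 Bc2 sP(1) sm(1) sp(1) by (simp add: B_def append_rows_def)
    also have "\<dots> = (\<Sum>h<card Jf. submatrix Q Jp Jf $$ (i, h) * Pp $$ (h, l))"
      by (rule mult_mat_index_sum[OF sp(1) sP(1) True il(2)])
    finally show ?thesis using True il by (simp add: D_def C_def idx_def sg_def sp(2) sP(2))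
  next
    case False
    have i': "i - card Jp < card Jm" using False il by simp
    have "B $$ (i, l) = - (submatrix Q Jm Jf * Pp) $$ (i - card Jp, l)"
      using False il i' Bc1 Bc2 sP(1) sm(1) sp(1) by (simp add: B_def append_rows_def)
    also have "(submatrix Q Jm Jf * Pp) $$ (i - card Jp, l)
        = (\<Sum>h<card Jf. submatrix Q Jm Jf $$ (i - card Jp, h) * Pp $$ (h, l))"
      by (rule mult_mat_index_sum[OF sm(1) sP(1) i' il(2)])
    finally show ?thesis using False il i'
      by (simp add: D_def C_def idx_def sg_def sm(2) sP(2) sum_negf)
  qed
  have F: "F \<in> carrier_mat k k" unfolding F_def using spp(1) smm(1) by (rule four_block_carrier_mat)
  have Fi: "F $$ (i, j) = M i j" if "i < k" "j < k" for i j
    using that spp spm smp smm by (auto simp: F_def M_def idx_def sg_def)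
  have S: "S = F - B * Y * transpose_mat B"
    unfolding S_def schur_complement_def Let_def Pp_def[symmetric] Xp_def[symmetric]
    by (simp add: inv F_def B_def)
  have BY: "B * Y \<in> carrier_mat k p" using B Y by simp
  have BT: "transpose_mat B \<in> carrier_mat p k" using B by simp
  show "S \<in> carrier_mat k k" unfolding S by (rule minus_carrier_mat[OF mult_carrier_mat[OF BY BT]])
  fix i j assume ij: "i < k" "j < k"
  have BYi: "(B * Y) $$ (i, l) = D P i (pick ?Z l) / X $$ (pick ?Z l, pick ?Z l)" if l: "l < p" for l
  proof -
    have "(B * Y) $$ (i, l) = (\<Sum>h<p. B $$ (i, h) * Y $$ (h, l))"
      by (rule mult_mat_index_sum[OF B Y ij(1) l])
    also have "\<dots> = (\<Sum>h<p. if h = l then D P i (pick ?Z l) / X $$ (pick ?Z l, pick ?Z l) else 0)"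
      using l ij by (intro sum.cong refl) (auto simp: Y_def Bi sX(2))
    finally show ?thesis using l by simp
  qed
  have "(B * Y * transpose_mat B) $$ (i, j) = (\<Sum>l<p. (B * Y) $$ (i, l) * transpose_mat B $$ (l, j))"
    by (rule mult_mat_index_sum[OF BY BT ij])
  also have "\<dots> = (\<Sum>l<p. D P i (pick ?Z l) * D P j (pick ?Z l) / X $$ (pick ?Z l, pick ?Z l))"
    using ij B by (intro sum.cong refl) (auto simp: BYi Bi)
  also have "\<dots> = (\<Sum>l\<in>?Z. D P i l * D P j l / X $$ (l, l))"
    by (rule sum.reindex_bij_betw[OF bijZ])
  finally show "S $$ (i, j)
      = M i j - (\<Sum>l | l < card Jf \<and> X $$ (l, l) > 0. D P i l * D P j l / X $$ (l, l))"
    using ij F BY BT by (simp add: S Fi pos_eigs_eq)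
qed

text \<open>\<open>copositive_on\<close> includes symmetry, which follows here from the entry
  formula. Vectors of the orthant are replaced by functions to match
  \<open>block_form_nonneg_iff\<close>.\<close>

lemma copositive_schur_complement_iff:
  "copositive_on (schur_complement Q Jp Jm Jf P X) (nonneg_orthant (card (Jp \<union> Jm))) \<longleftrightarrow>
   (\<forall>w. (\<forall>i<k. w i \<ge> 0) \<longrightarrow> 0 \<le> (\<Sum>i<k. \<Sum>j<k.
     (M i j - (\<Sum>l | l < card Jf \<and> X $$ (l, l) > 0. D P i l * D P j l / X $$ (l, l))) * w i * w j))"
proof -
  define S where "S = schur_complement Q Jp Jm Jf P X"
  note S = schur_complement_entries[folded S_def]
  have "symmetric S"
  proof (rule symmetricI[OF S(1)])
    fix i j assume ij: "i < k" "j < k"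
    have "M i j = M j i" using symmetric_index[OF Q(2,1) idx_less idx_less] ij by (simp add: M_def)
    thus "S $$ (i, j) = S $$ (j, i)" using ij by (simp add: S(2) mult.commute)
  qed
  moreover have "quad_form S v = (\<Sum>i<k. \<Sum>j<k.
     (M i j - (\<Sum>l | l < card Jf \<and> X $$ (l, l) > 0. D P i l * D P j l / X $$ (l, l))) * v $ i * v $ j)"
    if "v \<in> carrier_vec k" for v
    unfolding quad_form_sum[OF S(1) that] by (intro sum.cong refl) (simp add: S(2))
  ultimately have "copositive_on S (nonneg_orthant (card (Jp \<union> Jm))) \<longleftrightarrow>
     (\<forall>v\<in>carrier_vec k. (\<forall>i<k. v $ i \<ge> 0) \<longrightarrow> 0 \<le> (\<Sum>i<k. \<Sum>j<k.
     (M i j - (\<Sum>l | l < card Jf \<and> X $$ (l, l) > 0. D P i l * D P j l / X $$ (l, l))) * v $ i * v $ j))"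
    by (auto simp: copositive_on_def nonneg_orthant_def card_k)
  also have "\<dots> \<longleftrightarrow> (\<forall>w. (\<forall>i<k. w i \<ge> 0) \<longrightarrow> 0 \<le> (\<Sum>i<k. \<Sum>j<k.
     (M i j - (\<Sum>l | l < card Jf \<and> X $$ (l, l) > 0. D P i l * D P j l / X $$ (l, l))) * w i * w j))"
    (is "?A \<longleftrightarrow> ?B")
  proof
    assume A: ?A
    show ?B
    proof (intro allI impI)
      fix w :: "nat \<Rightarrow> real" assume "\<forall>i<k. w i \<ge> 0"
      thus "0 \<le> (\<Sum>i<k. \<Sum>j<k.
     (M i j - (\<Sum>l | l < card Jf \<and> X $$ (l, l) > 0. D P i l * D P j l / X $$ (l, l))) * w i * w j)"
        using A[rule_format, of "vec k w"] by simp
    qed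
  qed blast
  finally show ?thesis by (simp add: S_def)
qed

lemma quad_form_nonneg_on_cone_iff_schur:
  "(\<forall>v\<in>cone. 0 \<le> quad_form Q v) \<longleftrightarrow>
   pos_semidef Qff \<and> kernel_condition Q Jp Jm Jf P X \<and>
   copositive_on (schur_complement Q Jp Jm Jf P X) (nonneg_orthant (card (Jp \<union> Jm)))"
  unfolding quad_form_nonneg_on_cone_iff block_form_nonneg_iff
    pos_semidef_iff_eigenvalues[OF dec Qff] kernel_condition_iff copositive_schur_complement_iff ..

end

end

section \<open>The feasible set and the optimum value\<close>

text \<open>The expression is \<open>(c + a) * t\<close> for positive \<open>t\<close> and
  \<open>(c - a) * t\<close> for negative \<open>t\<close>, so a sign of \<open>t\<close> is allowed
  exactly when the corresponding factor vanishes.\<close>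

lemma weighted_abs_eq_0_iff:
  fixes a c t :: real
  assumes "\<bar>c\<bar> \<le> a"
  shows "c * t + a * \<bar>t\<bar> = 0 \<longleftrightarrow>
    (- c = a \<and> a > 0 \<longrightarrow> t \<ge> 0) \<and> (c = a \<and> a > 0 \<longrightarrow> t \<le> 0) \<and>
    (\<not> (- c = a \<and> a > 0) \<and> \<not> (c = a \<and> a > 0) \<and> \<not> (c = 0 \<and> a = 0) \<longrightarrow> t = 0)"
proof -
  consider "t > 0" | "t = 0" | "t < 0" by linarith
  thus ?thesis
  proof cases
    case 1
    hence "c * t + a * \<bar>t\<bar> = (c + a) * t" by (simp add: algebra_simps)
    thus ?thesis using 1 assms by auto
  next
    case 3
    hence "c * t + a * \<bar>t\<bar> = (c - a) * t" by (simp add: algebra_simps)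
    thus ?thesis using 3 assms by auto
  qed auto
qed

text \<open>A sum of nonnegative terms is at most zero only if every term is zero, which reduces the
  constraint to one condition per coordinate.\<close>

lemma feasible_eq:
  assumes b: "b \<in> carrier_vec n" and b_le: "\<forall>i<n. \<bar>b $ i\<bar> \<le> \<alpha> $ i"
  shows "feasible n b \<alpha> = {v \<in> carrier_vec n. (\<forall>s\<in>I_plus n b \<alpha>. v $ s \<ge> 0) \<and>
     (\<forall>s\<in>I_minus n b \<alpha>. v $ s \<le> 0) \<and>
     (\<forall>s<n. s \<notin> I_plus n b \<alpha> \<union> I_minus n b \<alpha> \<union> I_free n b \<alpha> \<longrightarrow> v $ s = 0)}"
proof -
  have "b \<bullet> v + (\<Sum>i<n. \<alpha> $ i * \<bar>v $ i\<bar>) \<le> 0 \<longleftrightarrow> (\<forall>i<n. b $ i * v $ i + \<alpha> $ i * \<bar>v $ i\<bar> = 0)"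
    if v: "v \<in> carrier_vec n" for v
  proof -
    have eq: "b \<bullet> v + (\<Sum>i<n. \<alpha> $ i * \<bar>v $ i\<bar>) = (\<Sum>i<n. b $ i * v $ i + \<alpha> $ i * \<bar>v $ i\<bar>)"
      using v b by (simp add: scalar_prod_def atLeast0LessThan sum.distrib)
    have nn: "b $ i * v $ i + \<alpha> $ i * \<bar>v $ i\<bar> \<ge> 0" if "i \<in> {..<n}" for i
    proof -
      have "\<bar>b $ i * v $ i\<bar> \<le> \<alpha> $ i * \<bar>v $ i\<bar>"
        using b_le that by (simp add: abs_mult mult_right_mono)
      thus ?thesis by linarith
    qed
    have "0 \<le> (\<Sum>i<n. b $ i * v $ i + \<alpha> $ i * \<bar>v $ i\<bar>)"
      by (rule sum_nonneg[OF nn])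
    moreover have "(\<Sum>i<n. b $ i * v $ i + \<alpha> $ i * \<bar>v $ i\<bar>) = 0 \<longleftrightarrow>
        (\<forall>i\<in>{..<n}. b $ i * v $ i + \<alpha> $ i * \<bar>v $ i\<bar> = 0)"
      by (rule sum_nonneg_eq_0_iff[OF finite_lessThan nn])
    ultimately show ?thesis unfolding eq by auto
  qed
  moreover have "(\<forall>i<n. b $ i * v $ i + \<alpha> $ i * \<bar>v $ i\<bar> = 0) \<longleftrightarrow>
     (\<forall>s\<in>I_plus n b \<alpha>. v $ s \<ge> 0) \<and> (\<forall>s\<in>I_minus n b \<alpha>. v $ s \<le> 0) \<and>
     (\<forall>s<n. s \<notin> I_plus n b \<alpha> \<union> I_minus n b \<alpha> \<union> I_free n b \<alpha> \<longrightarrow> v $ s = 0)" for v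
  proof -
    have "(\<forall>i<n. b $ i * v $ i + \<alpha> $ i * \<bar>v $ i\<bar> = 0) \<longleftrightarrow>
      (\<forall>i<n. (i \<in> I_plus n b \<alpha> \<longrightarrow> v $ i \<ge> 0) \<and> (i \<in> I_minus n b \<alpha> \<longrightarrow> v $ i \<le> 0) \<and>
        (i \<notin> I_plus n b \<alpha> \<union> I_minus n b \<alpha> \<union> I_free n b \<alpha> \<longrightarrow> v $ i = 0))"
      using weighted_abs_eq_0_iff[OF b_le[rule_format]]
      by (intro all_cong) (simp add: I_plus_def I_minus_def I_free_def)
    moreover have "I_plus n b \<alpha> \<subseteq> {..<n}" "I_minus n b \<alpha> \<subseteq> {..<n}"
      by (auto simp: I_plus_def I_minus_def)
    ultimately show ?thesis by blast
  qed
  ultimately show ?thesis unfolding feasible_def by blast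
qed

text \<open>The zero vector is feasible with value zero, so a nonnegative objective attains its
  minimum there.\<close>

lemma zero_optimum_iff:
  "is_optimum_value (\<lambda>v. 1/2 * quad_form Q v) (feasible n b \<alpha>) 0 \<longleftrightarrow>
   (\<forall>v\<in>feasible n b \<alpha>. 0 \<le> quad_form Q v)" (is "?L \<longleftrightarrow> ?R")
  if Q: "Q \<in> carrier_mat n n" and b: "b \<in> carrier_vec n"
proof
  show ?R if ?L
    using that by (force simp: is_optimum_value_def is_arg_min_def not_less)
  show ?L if ?R
  proof -
    have "0\<^sub>v n \<in> feasible n b \<alpha>" using b by (simp add: feasible_def)
    moreover have "quad_form Q (0\<^sub>v n) = 0" using Q by (simp add: quad_form_def)
    ultimately show ?thesis
      using that by (auto simp: is_optimum_value_def is_arg_min_def not_less intro!: exI[of _ "0\<^sub>v n"])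
  qed
qed

theorem proposition15:
  fixes n :: nat and Q :: "real mat" and b \<alpha> :: "real vec"
  assumes Q: "Q \<in> carrier_mat n n" "symmetric Q" "indefinite Q"
    and b: "b \<in> carrier_vec n"
    and \<alpha>: "\<alpha> \<in> carrier_vec n" "\<forall>i<n. \<alpha> $ i \<ge> 0" "\<alpha> \<noteq> 0\<^sub>v n"
    and b_le: "\<forall>i<n. \<bar>b $ i\<bar> \<le> \<alpha> $ i"
  shows
    "let Jp = I_plus n b \<alpha>; Jm = I_minus n b \<alpha>; Jf = I_free n b \<alpha>;
         Qff = submatrix Q Jf Jf;
         zero_optimum = is_optimum_value (\<lambda>v. 1/2 * quad_form Q v) (feasible n b \<alpha>) 0
     in
       (zero_optimum \<longleftrightarrow>
          pos_semidef Qff \<and>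
          (\<exists>P \<Xi>. eigen_decomposition Qff P \<Xi> \<and>
             kernel_condition Q Jp Jm Jf P \<Xi> \<and>
             copositive_on (schur_complement Q Jp Jm Jf P \<Xi>)
               (nonneg_orthant (card (Jp \<union> Jm))))) \<and>
       (\<forall>P \<Xi>. eigen_decomposition Qff P \<Xi> \<longrightarrow>
          (zero_optimum \<longleftrightarrow>
             pos_semidef Qff \<and>
             kernel_condition Q Jp Jm Jf P \<Xi> \<and>
             copositive_on (schur_complement Q Jp Jm Jf P \<Xi>)
               (nonneg_orthant (card (Jp \<union> Jm)))))"
proof -
  define Jp Jm Jf where J: "Jp = I_plus n b \<alpha>" "Jm = I_minus n b \<alpha>" "Jf = I_free n b \<alpha>"
  interpret signed_blocks n Q Jp Jm Jf
    by unfold_locales (use Q in \<open>auto simp: J I_plus_def I_minus_def I_free_def\<close>)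
  define opt where "opt = is_optimum_value (\<lambda>v. 1/2 * quad_form Q v) (feasible n b \<alpha>) 0"
  have feas: "feasible n b \<alpha> = cone"
    unfolding cone_def unfolding J by (rule feasible_eq[OF b b_le])
  have "opt \<longleftrightarrow> (\<forall>v\<in>cone. 0 \<le> quad_form Q v)"
    unfolding opt_def zero_optimum_iff[OF Q(1) b] by (simp only: feas)
  hence main: "opt \<longleftrightarrow> pos_semidef Qff \<and> kernel_condition Q Jp Jm Jf P \<Xi> \<and>
      copositive_on (schur_complement Q Jp Jm Jf P \<Xi>) (nonneg_orthant (card (Jp \<union> Jm)))"
    if "eigen_decomposition Qff P \<Xi>" for P \<Xi>
    using quad_form_nonneg_on_cone_iff_schur[OF that] by simp
  \<comment> \<open>\<open>main\<close> covers every decomposition; existence of one supplies the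
    witness for the existential half.\<close>
  obtain P0 \<Xi>0 where "eigen_decomposition Qff P0 \<Xi>0"
    using eigen_decomposition_exists[OF Qff(2)] by blast
  with main show ?thesis
    unfolding Let_def J[symmetric] opt_def[symmetric] by blast
qed

end
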